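(* Let $G$ be the combinatorial graph with 20 vertices obtained from the cube graph by subdividing each of its 12 edges with one additional vertex. Split the 8 original cube vertices into the two bipartition classes of the cube, $A$ and $B$ (4 vertices each), and let $C$ be the set of the 12 subdividing vertices, so that each vertex of $C$ is adjacent to exactly one vertex of $A$ and exactly one vertex of $B$. For real parameters $a,b,c,\alpha,\beta$, let $H$ be the real symmetric $20\times 20$ matrix indexed by the vertices of $G$ whose diagonal entries are $a$ at vertices of $A$, $b$ at vertices of $B$ and $c$ at vertices of $C$, whose off-diagonal entries are $\alpha$ for each edge of $G$ between $A$ and $C$ and $\beta$ for each edge of $G$ between $B$ and $C$, and whose other off-diagonal entries are $0$. Then for all values of $a,b,c,\alpha,\beta\in\mathbb{R}$, $c$ is an eigenvalue of $H$ of multiplicity at least $5$, and the corresponding eigenspace is a reducible representation of the symmetry group of the weighted graph.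
   Context: $H$ is the discrete Schrödinger operator on $G$ with vertex potentials $a,b,c$ and coupling weights $\alpha,\beta$. The symmetry group is the group of automorphisms of the graph $G$ that preserve the vertex potentials and the edge weights. It acts on vectors indexed by the vertices of $G$ by $(Su)(v)=u(s^{-1}(v))$; these operators commute with $H$, so each eigenspace of $H$ is a representation of this group. Representations are over $\mathbb{C}$ (or over $\mathbb{R}$). *)

theory Defs
  imports "HOL-Analysis.Analysis" "HOL-Algebra.Group"
begin

text \<open>
  A graph on a finite vertex type is given by its adjacency relation \<open>adj\<close>, with vertex
  potentials \<open>p\<close> and edge weights \<open>w\<close>; \<open>w x y\<close> is only meaningful if \<open>adj x y\<close>.
\<close>

definition schroedinger ::
  "('v::finite \<Rightarrow> 'v \<Rightarrow> bool) \<Rightarrow> ('v \<Rightarrow> real) \<Rightarrow> ('v \<Rightarrow> 'v \<Rightarrow> real) \<Rightarrow> real^'v^'v" where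
  "schroedinger adj p w =
     (\<chi> x y. if x = y then p x else if adj x y then w x y else 0)"

definition symmetry_group ::
  "('v \<Rightarrow> 'v \<Rightarrow> bool) \<Rightarrow> ('v \<Rightarrow> real) \<Rightarrow> ('v \<Rightarrow> 'v \<Rightarrow> real) \<Rightarrow> ('v \<Rightarrow> 'v) monoid" where
  "symmetry_group adj p w =
     \<lparr>carrier = {s. bij s
        \<and> (\<forall>x y. adj (s x) (s y) \<longleftrightarrow> adj x y)
        \<and> (\<forall>x. p (s x) = p x)
        \<and> (\<forall>x y. adj x y \<longrightarrow> w (s x) (s y) = w x y)},
      mult = (\<circ>), one = id\<rparr>"

text \<open>\<open>inv_into UNIV s\<close> is the inverse of \<open>s\<close>; its short form clashes with group inverses.\<close>

definition vertex_action :: "('v::finite \<Rightarrow> 'v) \<Rightarrow> 'k^'v \<Rightarrow> 'k^'v" where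
  "vertex_action s u = (\<chi> v. u $ (inv_into UNIV s v))"

lemma group_symmetry_group: "group (symmetry_group adj p w)"
proof (rule groupI)
  fix s assume "s \<in> carrier (symmetry_group adj p w)"
  then have b: "bij s" and s: "\<And>x y. adj (s x) (s y) \<longleftrightarrow> adj x y" "\<And>x. p (s x) = p x"
      "\<And>x y. adj x y \<Longrightarrow> w (s x) (s y) = w x y"
    by (simp_all add: symmetry_group_def)
  define t where "t = inv_into UNIV s"
  have r: "s (t x) = x" for x
    unfolding t_def using b by (simp add: bij_is_surj surj_f_inv_f)
  have l: "t \<circ> s = id"
    unfolding t_def using b by (simp add: bij_is_inj)
  have "bij t" unfolding t_def using b by (rule bij_imp_bij_inv)
  moreover have adj: "adj (t x) (t y) \<longleftrightarrow> adj x y" for x y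
    using s(1)[of "t x" "t y"] by (simp add: r)
  moreover have "p (t x) = p x" for x
    using s(2)[of "t x"] by (simp add: r)
  moreover have "w (t x) (t y) = w x y" if "adj x y" for x y
    using s(3)[of "t x" "t y"] that by (simp add: r adj)
  ultimately have "t \<in> carrier (symmetry_group adj p w)"
    by (simp add: symmetry_group_def)
  then show "\<exists>t\<in>carrier (symmetry_group adj p w).
      t \<otimes>\<^bsub>symmetry_group adj p w\<^esub> s = \<one>\<^bsub>symmetry_group adj p w\<^esub>"
    using l by (intro bexI[of _ t]) (simp_all add: symmetry_group_def)
qed (simp_all add: symmetry_group_def bij_comp comp_assoc)

text \<open>
  The dimension is taken over the scalar field \<open>'k\<close> (\<^const>\<open>vec.dim\<close>), which for
  \<open>'k = complex\<close> is not the real dimension \<^const>\<open>dim\<close>.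
\<close>

definition eigenspace :: "'k::field^'n^'n \<Rightarrow> 'k \<Rightarrow> ('k^'n) set" where
  "eigenspace M l = {u. M *v u = l *s u}"

definition eigenvalue :: "'k::field^'n^'n \<Rightarrow> 'k \<Rightarrow> bool" where
  "eigenvalue M l \<longleftrightarrow> (\<exists>u. u \<noteq> 0 \<and> M *v u = l *s u)"

definition eigen_multiplicity :: "'k::field^'n^'n \<Rightarrow> 'k \<Rightarrow> nat" where
  "eigen_multiplicity M l = vec.dim (eigenspace M l)"

definition scalar_extension :: "real^'n^'m \<Rightarrow> 'k::real_field^'n^'m" where
  "scalar_extension M = (\<chi> i j. of_real (M $ i $ j))"

definition representation ::
  "('g, 'r) monoid_scheme \<Rightarrow> ('g \<Rightarrow> 'k::field^'n \<Rightarrow> 'k^'n) \<Rightarrow> ('k^'n) set \<Rightarrow> bool" where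
  "representation G \<rho> V \<longleftrightarrow> group G \<and> vec.subspace V
     \<and> (\<forall>g\<in>carrier G. \<forall>x\<in>V. \<rho> g x \<in> V)
     \<and> (\<forall>g\<in>carrier G. \<forall>x\<in>V. \<forall>y\<in>V. \<rho> g (x + y) = \<rho> g x + \<rho> g y)
     \<and> (\<forall>g\<in>carrier G. \<forall>k. \<forall>x\<in>V. \<rho> g (k *s x) = k *s \<rho> g x)
     \<and> (\<forall>x\<in>V. \<rho> \<one>\<^bsub>G\<^esub> x = x)
     \<and> (\<forall>g\<in>carrier G. \<forall>h\<in>carrier G. \<forall>x\<in>V. \<rho> (g \<otimes>\<^bsub>G\<^esub> h) x = \<rho> g (\<rho> h x))"

definition reducible_representation ::
  "('g, 'r) monoid_scheme \<Rightarrow> ('g \<Rightarrow> 'k::field^'n \<Rightarrow> 'k^'n) \<Rightarrow> ('k^'n) set \<Rightarrow> bool" where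
  "reducible_representation G \<rho> V \<longleftrightarrow> representation G \<rho> V
     \<and> (\<exists>W. W \<subseteq> V \<and> W \<noteq> {0} \<and> W \<noteq> V \<and> representation G \<rho> W)"

type_synonym cube_vertex = "bool^3"

definition cube_adj :: "cube_vertex \<Rightarrow> cube_vertex \<Rightarrow> bool" where
  "cube_adj x y \<longleftrightarrow> card {i. x $ i \<noteq> y $ i} = 1"

typedef cube_edge = "{{x, y} | x y. cube_adj x y}"
  morphisms ends Edge
proof -
  have "{i::3. (vec False :: cube_vertex) $ i \<noteq> (\<chi> i. i = 1) $ i} = {1}" by auto
  then have "cube_adj (vec False) (\<chi> i. i = 1)" unfolding cube_adj_def by simp
  then show ?thesis by blast
qed

instance cube_edge :: finite
proof
  have "inj ends" by (simp add: inj_def ends_inject)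
  then show "finite (UNIV :: cube_edge set)" by (rule finite_imageD[rotated]) (rule finite)
qed

datatype vertex = Corner cube_vertex | Mid cube_edge

instance vertex :: finite
proof
  have "(UNIV :: vertex set) = range Corner \<union> range Mid"
  proof (rule Set.set_eqI)
    fix v show "v \<in> UNIV \<longleftrightarrow> v \<in> range Corner \<union> range Mid" by (cases v) simp_all
  qed
  moreover have "finite (range Corner \<union> range Mid)"
    by (intro finite_UnI finite_imageI finite)
  ultimately show "finite (UNIV :: vertex set)" by (rule ssubst)
qed

fun adj_G :: "vertex \<Rightarrow> vertex \<Rightarrow> bool" where
  "adj_G (Corner x) (Mid e) \<longleftrightarrow> x \<in> ends e"
| "adj_G (Mid e) (Corner x) \<longleftrightarrow> x \<in> ends e"
| "adj_G _ _ \<longleftrightarrow> False"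

definition cube_bipartition :: "cube_vertex set \<Rightarrow> cube_vertex set \<Rightarrow> bool" where
  "cube_bipartition A B \<longleftrightarrow> A \<union> B = UNIV \<and> A \<inter> B = {}
     \<and> (\<forall>x y. cube_adj x y \<longrightarrow> (x \<in> A \<and> y \<in> B) \<or> (x \<in> B \<and> y \<in> A))"

definition potential ::
  "cube_vertex set \<Rightarrow> cube_vertex set \<Rightarrow> real \<Rightarrow> real \<Rightarrow> real \<Rightarrow> vertex \<Rightarrow> real" where
  "potential A B a b c v =
     (if v \<in> Corner ` A then a else if v \<in> Corner ` B then b else c)"

text \<open>Every edge of the subdivided cube has exactly one end among the corners.\<close>

definition weight ::
  "cube_vertex set \<Rightarrow> cube_vertex set \<Rightarrow> real \<Rightarrow> real \<Rightarrow> vertex \<Rightarrow> vertex \<Rightarrow> real" where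
  "weight A B \<alpha> \<beta> v w =
     (if v \<in> Corner ` A \<or> w \<in> Corner ` A then \<alpha>
      else if v \<in> Corner ` B \<or> w \<in> Corner ` B then \<beta> else 0)"

definition H_G ::
  "cube_vertex set \<Rightarrow> cube_vertex set \<Rightarrow> real \<Rightarrow> real \<Rightarrow> real \<Rightarrow> real \<Rightarrow> real \<Rightarrow> real^vertex^vertex" where
  "H_G A B a b c \<alpha> \<beta> = schroedinger adj_G (potential A B a b c) (weight A B \<alpha> \<beta>)"

definition Sym_G ::
  "cube_vertex set \<Rightarrow> cube_vertex set \<Rightarrow> real \<Rightarrow> real \<Rightarrow> real \<Rightarrow> real \<Rightarrow> real \<Rightarrow> (vertex \<Rightarrow> vertex) monoid" where
  "Sym_G A B a b c \<alpha> \<beta> = symmetry_group adj_G (potential A B a b c) (weight A B \<alpha> \<beta>)"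

end

theory Submission
  imports Defs
begin

text \<open>
  A vector that vanishes on the corners and whose values on the three edges at each corner add
  up to zero lies in the eigenspace of \<open>c\<close>, whatever the parameters are. The alternating
  sign vectors on the six faces of the cube are of this kind, and their only linear relation is
  that they add up to zero; this gives dimension at least five. The eigenvectors that take
  equal values on vertices opposite in an 8-cycle (the subdivision of a face) form an
  invariant subspace, since 8-cycles are preserved by all automorphisms. It is proper because it
  contains the sum of the vectors of two opposite faces, but not the vector of one face.
\<close>

section \<open>Representations on eigenspaces of Schroedinger operators\<close>

lemma vertex_action_nth: "bij s \<Longrightarrow> vertex_action s u $ s v = u $ v"
  by (simp add: vertex_action_def bij_is_inj)

lemma bij_vec_eqI:
  assumes "bij s" "\<And>v. x $ s v = y $ s v"
  shows "x = y"
proof -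
  have "x $ v = y $ v" for v
    using assms(2)[of "inv_into UNIV s v"] assms(1)
    by (simp add: bij_is_surj surj_f_inv_f)
  then show ?thesis by (simp add: vec_eq_iff)
qed

lemma representation_vertex_action:
  fixes V :: "('k::field^'v::finite) set"
  assumes "vec.subspace V"
    and "\<And>s u. s \<in> carrier (symmetry_group adj p w) \<Longrightarrow> u \<in> V \<Longrightarrow> vertex_action s u \<in> V"
  shows "representation (symmetry_group adj p w) vertex_action V"
proof -
  have bij: "bij s" if "s \<in> carrier (symmetry_group adj p w)" for s
    using that by (simp add: symmetry_group_def)
  have comp: "vertex_action (s \<circ> t) u = vertex_action s (vertex_action t u)"
    if "bij s" "bij t" for s t :: "'v \<Rightarrow> 'v" and u :: "'k^'v"
    using that by (simp add: vertex_action_def vec_eq_iff o_inv_distrib)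
  have linear: "vertex_action s (u + u') = vertex_action s u + vertex_action s u'"
    "vertex_action s (k *s u) = k *s vertex_action s u" "vertex_action id u = u"
    for s :: "'v \<Rightarrow> 'v" and u u' :: "'k^'v" and k
    by (simp_all add: vertex_action_def vec_eq_iff)
  have "\<one>\<^bsub>symmetry_group adj p w\<^esub> = id"
    "s \<otimes>\<^bsub>symmetry_group adj p w\<^esub> t = s \<circ> t" for s t
    by (simp_all add: symmetry_group_def)
  then show ?thesis
    unfolding representation_def
    using assms by (simp add: group_symmetry_group linear comp bij)
qed

lemma subspace_eigenspace: "vec.subspace (eigenspace M l)"
proof (rule vec.subspaceI)
  show "k *s x \<in> eigenspace M l" if "x \<in> eigenspace M l" for k x
    using that by (simp add: eigenspace_def vector_scalar_commute mult.commute)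
qed (simp_all add: eigenspace_def matrix_vector_right_distrib vector_add_ldistrib)

lemma scalar_extension_schroedinger_invariant:
  assumes "s \<in> carrier (symmetry_group adj p w)"
  shows "scalar_extension (schroedinger adj p w) $ s x $ s y
    = scalar_extension (schroedinger adj p w) $ x $ y"
  using assms
  by (auto simp: scalar_extension_def schroedinger_def symmetry_group_def bij_def inj_eq)

lemma vertex_action_eigenspace:
  fixes u :: "'k::real_field^'v::finite"
  assumes s: "s \<in> carrier (symmetry_group adj p w)"
    and u: "u \<in> eigenspace (scalar_extension (schroedinger adj p w)) l"
  shows "vertex_action s u \<in> eigenspace (scalar_extension (schroedinger adj p w)) l"
proof -
  let ?M = "scalar_extension (schroedinger adj p w) :: 'k^'v^'v"
  have bij: "bij s" using s by (simp add: symmetry_group_def)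
  \<comment> \<open>Entries are compared at \<open>s v\<close>, where the action undoes
    \<open>s\<close>. Reindexing the sum by \<open>s\<close> moves \<open>s\<close> onto both matrix
    indices, under which the matrix is invariant.\<close>
  have "(?M *v vertex_action s u) $ s v = (l *s vertex_action s u) $ s v" for v
  proof -
    have "(?M *v vertex_action s u) $ s v = (\<Sum>y\<in>UNIV. ?M $ s v $ y * vertex_action s u $ y)"
      by (simp add: matrix_vector_mult_def)
    also have "\<dots> = (\<Sum>y\<in>UNIV. ?M $ s v $ s y * vertex_action s u $ s y)"
      using sum.reindex_bij_betw[OF bij, where g = "\<lambda>y. ?M $ s v $ y * vertex_action s u $ y"]
      by simp
    also have "\<dots> = (?M *v u) $ v"
      by (simp add: matrix_vector_mult_def vertex_action_nth[OF bij]
          scalar_extension_schroedinger_invariant[OF s])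
    finally show ?thesis
      using u by (simp add: eigenspace_def vertex_action_nth[OF bij])
  qed
  then show ?thesis
    unfolding eigenspace_def using bij_vec_eqI[OF bij] by blast
qed

section \<open>The edges of the cube\<close>

definition flip :: "3 \<Rightarrow> cube_vertex \<Rightarrow> cube_vertex" where
  "flip i x = (\<chi> j. if j = i then \<not> x $ j else x $ j)"

lemma flip_nth [simp]: "flip i x $ j = (if j = i then \<not> x $ j else x $ j)"
  by (simp add: flip_def)

lemma flip_flip [simp]: "flip i (flip i x) = x"
  by (simp add: vec_eq_iff)

lemma flip_commute: "flip i (flip j x) = flip j (flip i x)"
  by (simp add: vec_eq_iff)

lemma flip_neq [simp]: "flip i x \<noteq> x" "x \<noteq> flip i x"
  by (auto simp: vec_eq_iff)

lemma flip_inject [simp]: "flip i x = flip j x \<longleftrightarrow> i = j"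
  by (auto simp: vec_eq_iff split: if_splits)

text \<open>A double flip is determined by the set of coordinates flipped an odd number of
  times.\<close>

lemma flip_flip_eq_iff: "flip i (flip j x) = flip k (flip l x) \<longleftrightarrow> i = j \<and> k = l \<or> i = k \<and> j = l \<or> i = l \<and> j = k"
  by (auto simp: vec_eq_iff split: if_splits)

lemma cube_adj_iff_flip: "cube_adj x y \<longleftrightarrow> (\<exists>i. y = flip i x)"
proof
  assume "cube_adj x y"
  then obtain i where i: "{i. x $ i \<noteq> y $ i} = {i}"
    unfolding cube_adj_def using card_1_singletonE by blast
  have "y $ j = flip i x $ j" for j
    using i[THEN eqset_imp_iff, of j] by auto
  then show "\<exists>i. y = flip i x" by (auto simp: vec_eq_iff)
next
  assume "\<exists>i. y = flip i x"
  then obtain i where "y = flip i x" by blast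
  then have "{i. x $ i \<noteq> y $ i} = {i}" by auto
  then show "cube_adj x y" by (simp add: cube_adj_def)
qed

text \<open>An edge is named by an end and a direction, so each edge has exactly two names, and sums
  over the edges at a corner become sums over directions.\<close>

definition edge :: "cube_vertex \<Rightarrow> 3 \<Rightarrow> cube_edge" where
  "edge x i = Edge {x, flip i x}"

lemma ends_edge [simp]: "ends (edge x i) = {x, flip i x}"
  unfolding edge_def by (rule Edge_inverse) (auto simp: cube_adj_iff_flip)

lemma edge_flip: "edge (flip i x) i = edge x i"
  by (simp add: edge_def insert_commute)

lemma edge_eq_iff: "edge x i = edge y j \<longleftrightarrow> i = j \<and> (y = x \<or> y = flip i x)"
proof
  assume "edge x i = edge y j"
  then have "{x, flip i x} = {y, flip j y}" by (metis ends_edge)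
  then show "i = j \<and> (y = x \<or> y = flip i x)"
    by (metis doubleton_eq_iff flip_flip flip_inject)
qed (auto simp: edge_flip)

lemma edge_exhaust: obtains x i where "e = edge x i"
proof -
  have "ends e \<in> {{x, y} | x y. cube_adj x y}" by (rule ends)
  then obtain x i where "ends e = {x, flip i x}" by (auto simp: cube_adj_iff_flip)
  then have "e = edge x i" by (simp flip: ends_inject)
  then show thesis by (rule that)
qed

lemma mem_ends_iff: "x \<in> ends e \<longleftrightarrow> (\<exists>i. e = edge x i)"
  by (rule edge_exhaust[of e]) (auto simp: edge_eq_iff)

lemma sum_ends: "(\<Sum>e | x \<in> ends e. f e) = (\<Sum>i\<in>UNIV. f (edge x i))"
proof -
  have "{e. x \<in> ends e} = range (edge x)" by (auto simp: mem_ends_iff)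
  moreover have "inj (edge x)" by (auto simp: inj_def edge_eq_iff)
  ultimately show ?thesis by (simp add: sum.reindex)
qed

definition direction :: "cube_edge \<Rightarrow> 3" where
  "direction e = (THE i. \<exists>x. e = edge x i)"

lemma direction_edge [simp]: "direction (edge x i) = i"
  unfolding direction_def by (rule the_equality) (auto simp: edge_eq_iff)

lemma sum_vertex: "(\<Sum>v\<in>UNIV. f v) = (\<Sum>x\<in>UNIV. f (Corner x)) + (\<Sum>e\<in>UNIV. f (Mid e))"
proof -
  have "(UNIV :: vertex set) = range Corner \<union> range Mid"
    by (metis UNIV_eq_I UnCI rangeI vertex.exhaust)
  moreover have "range Corner \<inter> range Mid = {}" by auto
  ultimately have "sum f UNIV = sum f (range Corner) + sum f (range Mid)"
    using sum.union_disjoint[of "range Corner" "range Mid" f] by simp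
  then show ?thesis by (simp add: sum.reindex inj_def)
qed

section \<open>Opposite vertices of the faces\<close>

text \<open>The vertices \<open>v1, v2, v3, v4\<close> alternate with \<open>q\<close>, \<open>p\<close> and the two vertices \<open>m\<close> along
  an 8-cycle in which \<open>p\<close> and \<open>q\<close> are opposite.\<close>

definition opposite :: "('v \<Rightarrow> 'v \<Rightarrow> bool) \<Rightarrow> 'v \<Rightarrow> 'v \<Rightarrow> bool" where
  "opposite adj p q \<longleftrightarrow> (\<exists>v1 v2 v3 v4. distinct [v1, v2, v3, v4]
     \<and> adj v4 p \<and> adj v1 p \<and> adj v2 q \<and> adj v3 q
     \<and> (\<exists>m. adj v1 m \<and> adj v2 m) \<and> (\<exists>m. adj v3 m \<and> adj v4 m))"

text \<open>The relation is expressed through adjacency and distinctness alone, and \<open>s\<close>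
  preserves both.\<close>

lemma opposite_invariant:
  assumes "opposite adj p q" "bij s" "\<And>x y. adj (s x) (s y) \<longleftrightarrow> adj x y"
  shows "opposite adj (s p) (s q)"
proof -
  obtain v1 v2 v3 v4 m m' where "distinct [v1, v2, v3, v4]"
    "adj v4 p" "adj v1 p" "adj v2 q" "adj v3 q" "adj v1 m" "adj v2 m" "adj v3 m'" "adj v4 m'"
    using assms(1) unfolding opposite_def by blast
  then show ?thesis
    unfolding opposite_def using assms(2,3)
    by (intro exI[of _ "s v1"] exI[of _ "s v2"] exI[of _ "s v3"] exI[of _ "s v4"])
       (auto simp: bij_def inj_eq)
qed

lemma opposite_Mid:
  assumes "i \<noteq> k"
  shows "opposite adj_G (Mid (edge x i)) (Mid (edge (flip k x) i))"
  unfolding opposite_def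
proof (intro exI conjI)
  \<comment> \<open>These are the corners of the square through \<open>x\<close> in directions
    \<open>i\<close> and \<open>k\<close>, in cyclic order; the edges in direction \<open>k\<close>
    supply the two vertices \<open>m\<close>.\<close>
  show "distinct [Corner x, Corner (flip k x), Corner (flip i (flip k x)), Corner (flip i x)]"
    using assms by (auto simp: vec_eq_iff)
  show "adj_G (Corner x) (Mid (edge x k))" "adj_G (Corner (flip k x)) (Mid (edge x k))"
    "adj_G (Corner (flip i (flip k x))) (Mid (edge (flip i x) k))"
    "adj_G (Corner (flip i x)) (Mid (edge (flip i x) k))"
    by (simp_all add: flip_commute)
qed simp_all

lemma adj_G_Corner_iff: "adj_G (Corner x) v \<longleftrightarrow> (\<exists>i. v = Mid (edge x i))"
  by (cases v) (auto simp: mem_ends_iff)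

lemma adj_G_Mid_iff: "adj_G (Mid e) v \<longleftrightarrow> (\<exists>x. v = Corner x \<and> x \<in> ends e)"
  by (cases v) auto

text \<open>If \<open>v1\<close> is a corner, all four \<open>v\<close>s are corners of the cube,
  each obtained from the previous one by a flip; such a closed walk on distinct corners has parallel
  opposite sides. If \<open>v1\<close> is a midpoint, bipartiteness of \<open>G\<close> makes
  \<open>p\<close> and \<open>q\<close> corners.\<close>

lemma opposite_G_cases:
  assumes "opposite adj_G p q"
  obtains x y where "p = Corner x" "q = Corner y"
  | x y i where "p = Mid (edge x i)" "q = Mid (edge y i)"
proof -
  obtain v1 v2 v3 v4 m m' where v: "distinct [v1, v2, v3, v4]"
    "adj_G v4 p" "adj_G v1 p" "adj_G v2 q" "adj_G v3 q"
    "adj_G v1 m" "adj_G v2 m" "adj_G v3 m'" "adj_G v4 m'"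
    using assms unfolding opposite_def by blast
  show thesis
  proof (cases v1)
    case (Mid e)
    then obtain x z where "p = Corner x" "m = Corner z" using v by (auto simp: adj_G_Mid_iff)
    moreover then obtain e' where "v2 = Mid e'" using v by (cases v2) auto
    moreover then obtain y where "q = Corner y" using v by (auto simp: adj_G_Mid_iff)
    ultimately show thesis using that by blast
  next
    case (Corner x1)
    then obtain i j where p: "p = Mid (edge x1 i)" and m: "m = Mid (edge x1 j)"
      using v by (auto simp: adj_G_Corner_iff)
    have v2: "v2 = Corner (flip j x1)"
      using v Corner m by (cases v2) (auto simp: mem_ends_iff edge_eq_iff)
    have v4: "v4 = Corner (flip i x1)"
      using v Corner p by (cases v4) (auto simp: mem_ends_iff edge_eq_iff)
    obtain k where q: "q = Mid (edge (flip j x1) k)"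
      using v v2 by (auto simp: adj_G_Corner_iff)
    have v3: "v3 = Corner (flip k (flip j x1))"
      using v v2 q by (cases v3) (auto simp: mem_ends_iff edge_eq_iff)
    obtain l where "m' = Mid (edge (flip i x1) l)"
      using v v4 by (auto simp: adj_G_Corner_iff)
    then have "flip k (flip j x1) = flip l (flip i x1)"
      using v v3 v4 by (auto simp: mem_ends_iff edge_eq_iff)
    \<comment> \<open>Of the three ways in which double flips agree, \<open>k = j\<close> would give
      \<open>v3 = v1\<close> and \<open>i = j\<close> would give \<open>v2 = v4\<close>.\<close>
    then have "k = i"
      using v(1) Corner v2 v3 v4 by (auto simp: flip_flip_eq_iff)
    then show thesis using that(2) p q by blast
  qed
qed

definition opposite_equal :: "'k::field^vertex \<Rightarrow> bool" where
  "opposite_equal u \<longleftrightarrow> (\<forall>p q. opposite adj_G p q \<longrightarrow> u $ p = u $ q)"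

lemma opposite_equal_vertex_action:
  assumes "s \<in> carrier (symmetry_group adj_G p w)" "opposite_equal u"
  shows "opposite_equal (vertex_action s u)"
proof -
  have s: "bij s" "\<And>x y. adj_G (s x) (s y) \<longleftrightarrow> adj_G x y"
    using assms(1) by (auto simp: symmetry_group_def)
  \<comment> \<open>The action evaluates \<open>u\<close> at preimages, so invariance of the
    relation is applied to the inverse of \<open>s\<close>.\<close>
  define t where "t = inv_into UNIV s"
  have "s (t x) = x" for x
    unfolding t_def using s(1) by (simp add: bij_is_surj surj_f_inv_f)
  then have "adj_G (t x) (t y) \<longleftrightarrow> adj_G x y" for x y
    using s(2)[of "t x" "t y"] by simp
  moreover have "bij t" unfolding t_def using s(1) by (rule bij_imp_bij_inv)
  ultimately show ?thesis
    using assms(2) opposite_invariant[of adj_G _ _ t]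
    by (auto simp: opposite_equal_def vertex_action_def t_def)
qed

section \<open>The vectors of the faces\<close>

text \<open>Arithmetic in type \<open>3\<close> is modulo 3, so \<open>k + 1\<close> and
  \<open>k + 2\<close> are the directions of the edges of a face normal to \<open>k\<close>. With
  this cyclic choice the two faces at an edge give it opposite signs, so the six face vectors add up
  to zero.\<close>

definition face_sign :: "3 \<Rightarrow> 3 \<Rightarrow> 'k::field" where
  "face_sign k i = (if i = k + 1 then 1 else if i = k + 2 then - 1 else 0)"

lemma face_sign_same [simp]: "face_sign k k = 0"
  by (simp add: face_sign_def)

lemma sum_face_sign: "(\<Sum>i\<in>UNIV. face_sign k i) = 0"
  using exhaust_3[of k] by (auto simp: sum_3 face_sign_def)

text \<open>The pair \<open>(k, s)\<close> stands for the face on which coordinate \<open>k\<close>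
  equals \<open>s\<close>.\<close>

definition face_vec :: "3 \<times> bool \<Rightarrow> 'k::field^vertex" where
  "face_vec = (\<lambda>(k, s). \<chi> v. case v of Corner x \<Rightarrow> 0
     | Mid e \<Rightarrow> if \<forall>x\<in>ends e. x $ k = s then face_sign k (direction e) else 0)"

lemma face_vec_Corner [simp]: "face_vec p $ Corner x = 0"
  by (cases p) (simp add: face_vec_def)

text \<open>Testing one end suffices: for \<open>i \<noteq> k\<close> both ends agree in coordinate
  \<open>k\<close>, and for \<open>i = k\<close> the sign is 0.\<close>

lemma face_vec_Mid [simp]:
  "face_vec (k, s) $ Mid (edge x i) = (if x $ k = s then face_sign k i else 0)"
  by (auto simp: face_vec_def)

lemma scalar_extension_H_G_eigenspaceI:
  assumes "\<And>x. u $ Corner x = 0" "\<And>x. (\<Sum>i\<in>UNIV. u $ Mid (edge x i)) = 0"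
  shows "u \<in> eigenspace (scalar_extension (H_G A B a b c \<alpha> \<beta>)) (of_real c)"
proof -
  let ?M = "scalar_extension (H_G A B a b c \<alpha> \<beta>)"
  have row: "(?M *v u) $ v = (\<Sum>e\<in>UNIV. ?M $ v $ Mid e * u $ Mid e)" for v
    using assms(1) by (simp add: matrix_vector_mult_def sum_vertex)
  have "(?M *v u) $ v = of_real c * u $ v" for v
  proof (cases v)
    case (Corner x)
    \<comment> \<open>All edges at a corner carry one common weight, which factors out of the sum; 0
      is the default of \<open>weight\<close> for a corner outside both sets.\<close>
    define \<gamma> where "\<gamma> = (if x \<in> A then \<alpha> else if x \<in> B then \<beta> else 0)"
    have "(?M *v u) $ v = (\<Sum>e\<in>UNIV. if x \<in> ends e then of_real \<gamma> * u $ Mid e else 0)"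
      unfolding row Corner \<gamma>_def
      by (intro sum.cong) (auto simp: scalar_extension_def H_G_def schroedinger_def weight_def)
    also have "\<dots> = of_real \<gamma> * (\<Sum>e | x \<in> ends e. u $ Mid e)"
      by (simp add: sum_distrib_left flip: sum.inter_filter)
    also have "\<dots> = 0" by (simp add: sum_ends assms(2))
    finally show ?thesis using assms(1) Corner by simp
  next
    case (Mid e)
    have "(?M *v u) $ v = (\<Sum>f\<in>UNIV. if f = e then of_real c * u $ Mid e else 0)"
      unfolding row Mid
      by (intro sum.cong) (auto simp: scalar_extension_def H_G_def schroedinger_def potential_def)
    then show ?thesis using Mid by simp
  qed
  then show ?thesis by (simp add: eigenspace_def vec_eq_iff)
qed

text \<open>A corner of the face lies on two of its edges, with signs 1 and -1; at any other corner
  all three values are 0.\<close>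

lemma face_vec_eigenspace:
  "face_vec p \<in> eigenspace (scalar_extension (H_G A B a b c \<alpha> \<beta>)) (of_real c)"
proof (rule scalar_extension_H_G_eigenspaceI)
  fix x
  obtain k s where "p = (k, s)" by (cases p)
  then show "(\<Sum>i\<in>UNIV. face_vec p $ Mid (edge x i)) = 0"
    by (cases "x $ k = s") (simp_all add: sum_face_sign)
qed simp

text \<open>The entry of the relation at an edge involves only the two faces containing it, with
  opposite signs, so adjacent faces have equal coefficients. Any two faces are linked by a chain of
  adjacent ones.\<close>

lemma face_vec_relation:
  fixes f :: "3 \<times> bool \<Rightarrow> 'k::field"
  assumes "(\<Sum>p\<in>UNIV. f p *s face_vec p) = 0"
  shows "f p = f q"
proof -
  have *: "(\<Sum>p\<in>UNIV. f p * face_vec p $ v) = 0" for v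
    using assms by (simp add: vec_eq_iff)
  have sum: "(\<Sum>p\<in>UNIV. g p) = (\<Sum>k\<in>UNIV. g (k, True) + g (k, False))"
    for g :: "3 \<times> bool \<Rightarrow> 'k"
  proof -
    have "(\<Sum>p\<in>UNIV. g p) = (\<Sum>k\<in>UNIV. \<Sum>s\<in>UNIV. g (k, s))"
      by (simp add: sum.cartesian_product)
    then show ?thesis by (simp add: UNIV_bool add.commute)
  qed
  have numeral: "(4 :: 3) = 1" "(5 :: 3) = 2" by simp_all
  have eq: "f (i + 1, s) = f (i + 2, t)" for i s t
  proof -
    \<comment> \<open>The edge in direction \<open>i\<close> at this corner is the common edge of
      the faces \<open>(i + 1, s)\<close> and \<open>(i + 2, t)\<close>.\<close>
    define x :: cube_vertex where "x = (\<chi> j. if j = i + 1 then s else t)"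
    show ?thesis
      using *[of "Mid (edge x i)"] exhaust_3[of i]
      by (cases s; cases t) (auto simp: sum sum_3 x_def face_sign_def numeral)
  qed
  have "f (k, s) = f (1, True)" for k s
  proof -
    \<comment> \<open>The faces normal to 2 and 3 are adjacent to \<open>(1, True)\<close>; a face
      normal to 1 is reached through \<open>(2, True)\<close>.\<close>
    have "f (1, s) = f (2, True)" "f (2, s) = f (1, True)" "f (3, s) = f (1, True)"
        "f (2, True) = f (1, True)"
      using eq[of 3 s True] eq[of 3 True s] eq[of 3 True True] eq[of 2 s True] by (simp_all add: numeral)
    then show ?thesis using exhaust_3[of k] by auto
  qed
  then show ?thesis by (metis surj_pair)
qed

section \<open>Dimension of the eigenspace\<close>

lemma dim_eigenspace_ge_5:
  "vec.dim (eigenspace (scalar_extension (H_G A B a b c \<alpha> \<beta>)) (of_real c :: 'k::real_field)) \<ge> 5"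
proof -
  let ?V = "eigenspace (scalar_extension (H_G A B a b c \<alpha> \<beta>)) (of_real c :: 'k)"
  define I where "I = - {(1 :: 3, True)}"
  define F where "F = (face_vec ` I :: ('k^vertex) set)"
  have zero: "f p = 0"
    if "(\<Sum>p\<in>I. f p *s face_vec p) = (0 :: 'k^vertex)" "p \<in> I" for f p
  proof -
    \<comment> \<open>Extending by 0 to the omitted face gives a relation among all six vectors; its
      equal coefficients must all be that 0.\<close>
    define g where "g p = (if p \<in> I then f p else 0)" for p
    have "(\<Sum>p\<in>UNIV. g p *s face_vec p) = (\<Sum>p\<in>I. f p *s face_vec p)"
      by (rule sum.mono_neutral_cong_right) (auto simp: g_def)
    then have "g p = g (1, True)" using that(1) by (intro face_vec_relation) simp
    then show ?thesis using that(2) by (simp add: g_def I_def)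
  qed
  have inj: "inj_on (face_vec :: _ \<Rightarrow> 'k^vertex) I"
  proof (rule inj_onI, rule ccontr)
    fix p q assume pq: "p \<in> I" "q \<in> I" "face_vec p = (face_vec q :: 'k^vertex)" "p \<noteq> q"
    \<comment> \<open>Two coinciding face vectors would give the nontrivial relation with
      coefficients 1 and -1.\<close>
    let ?f = "\<lambda>r. if r = p then 1 else if r = q then - 1 else (0 :: 'k)"
    have "(\<Sum>r\<in>I. ?f r *s face_vec r) = (\<Sum>r\<in>{p, q}. ?f r *s (face_vec r :: 'k^vertex))"
      using pq by (intro sum.mono_neutral_right) auto
    also have "\<dots> = 0" using pq by simp
    finally show False using zero[of ?f p] pq(1) by simp
  qed
  have "vec.independent F"
  proof (rule vec.independent_if_scalars_zero)
    fix f u assume f: "(\<Sum>u\<in>F. f u *s u) = 0" "u \<in> F"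
    then have "(\<Sum>p\<in>I. f (face_vec p) *s face_vec p) = 0"
      unfolding F_def by (simp add: sum.reindex[OF inj])
    then show "f u = 0" using zero[of "\<lambda>p. f (face_vec p)"] f(2) by (auto simp: F_def)
  qed (simp add: F_def)
  moreover have "F \<subseteq> ?V" by (auto simp: F_def face_vec_eigenspace)
  ultimately have "card F \<le> vec.dim ?V" by (intro vec.independent_card_le_dim)
  moreover have "card F = 5"
    unfolding F_def card_image[OF inj] by (simp add: I_def Compl_eq_Diff_UNIV card_Diff_subset)
  ultimately show ?thesis by simp
qed

section \<open>Reducibility of the eigenspace\<close>

lemma reducible_eigenspace:
  "reducible_representation (Sym_G A B a b c \<alpha> \<beta>) vertex_action
    (eigenspace (scalar_extension (H_G A B a b c \<alpha> \<beta>)) (of_real c :: 'k::real_field))"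
proof -
  let ?V = "eigenspace (scalar_extension (H_G A B a b c \<alpha> \<beta>)) (of_real c :: 'k)"
  define W where "W = {u \<in> ?V. opposite_equal u}"
  have "vec.subspace W"
    using subspace_eigenspace[of "scalar_extension (H_G A B a b c \<alpha> \<beta>)" "of_real c :: 'k"]
    unfolding W_def vec.subspace_def opposite_equal_def by (auto; metis)
  then have repr: "representation (Sym_G A B a b c \<alpha> \<beta>) vertex_action W"
    "representation (Sym_G A B a b c \<alpha> \<beta>) vertex_action ?V"
    unfolding Sym_G_def W_def H_G_def
    by (auto intro!: representation_vertex_action subspace_eigenspace
        vertex_action_eigenspace opposite_equal_vertex_action)
  \<comment> \<open>Each edge with nonzero sign lies in exactly one of these two opposite faces, so
    the value of \<open>u\<close> at a midpoint depends only on the direction of the edge.\<close>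
  define u :: "'k^vertex" where "u = face_vec (1, True) + face_vec (1, False)"
  have "u \<in> ?V"
    unfolding u_def by (intro vec.subspace_add subspace_eigenspace face_vec_eigenspace)
  moreover have "opposite_equal u"
    by (auto simp: opposite_equal_def u_def elim!: opposite_G_cases)
  moreover have "u $ Mid (edge x 2) = 1" for x
    by (simp add: u_def face_sign_def)
  then have "u \<noteq> 0" by (metis zero_index zero_neq_one)
  ultimately have "W \<noteq> {0}" unfolding W_def by blast
  moreover have "\<not> opposite_equal (face_vec (1, True) :: 'k^vertex)"
  proof
    assume "opposite_equal (face_vec (1, True) :: 'k^vertex)"
    \<comment> \<open>The edge in direction 2 at this corner lies in the face
      \<open>(1, True)\<close> and has sign 1; the parallel edge across coordinate 1 lies outside it
      and has value 0.\<close>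
    moreover define x :: cube_vertex where "x = vec True"
    have "opposite adj_G (Mid (edge x 2)) (Mid (edge (flip 1 x) 2))"
      by (rule opposite_Mid) simp
    ultimately have "face_vec (1, True) $ Mid (edge x 2)
      = (face_vec (1, True) :: 'k^vertex) $ Mid (edge (flip 1 x) 2)"
      unfolding opposite_equal_def by blast
    then show False by (simp add: x_def face_sign_def)
  qed
  then have "W \<noteq> ?V" unfolding W_def using face_vec_eigenspace by blast
  moreover have "W \<subseteq> ?V" by (auto simp: W_def)
  ultimately show ?thesis
    unfolding reducible_representation_def using repr by blast
qed

lemma eigenvalue_if_multiplicity_pos:
  assumes "eigen_multiplicity M l > 0"
  shows "eigenvalue M l"
proof (rule ccontr)
  assume "\<not> eigenvalue M l"
  then have "eigenspace M l \<subseteq> {0}" by (auto simp: eigenvalue_def eigenspace_def)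
  then have "eigen_multiplicity M l = 0" by (simp add: eigen_multiplicity_def)
  then show False using assms by simp
qed

lemma eigenvalue_H_G:
  "eigenvalue (scalar_extension (H_G A B a b c \<alpha> \<beta>)) (of_real c :: 'k::real_field)"
proof (rule eigenvalue_if_multiplicity_pos)
  show "eigen_multiplicity (scalar_extension (H_G A B a b c \<alpha> \<beta>)) (of_real c :: 'k) > 0"
    using dim_eigenspace_ge_5[of A B a b c \<alpha> \<beta>, where 'k = 'k]
    by (simp add: eigen_multiplicity_def)
qed

text \<open>The results above hold over every \<open>real_field\<close>; this turns their real
  instance into statements about the matrix itself.\<close>

lemma scalar_extension_real: "scalar_extension M = (M :: real^'n^'m)"
  by (simp add: scalar_extension_def)

theorem mainTheorem2:
  fixes A B :: "cube_vertex set" and a b c \<alpha> \<beta> :: real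
  assumes "cube_bipartition A B"
  shows "eigenvalue (H_G A B a b c \<alpha> \<beta>) c
    \<and> eigen_multiplicity (H_G A B a b c \<alpha> \<beta>) c \<ge> 5
    \<and> reducible_representation (Sym_G A B a b c \<alpha> \<beta>) vertex_action
        (eigenspace (H_G A B a b c \<alpha> \<beta>) c)
    \<and> eigenvalue (scalar_extension (H_G A B a b c \<alpha> \<beta>)) (complex_of_real c)
    \<and> eigen_multiplicity (scalar_extension (H_G A B a b c \<alpha> \<beta>)) (complex_of_real c) \<ge> 5
    \<and> reducible_representation (Sym_G A B a b c \<alpha> \<beta>) vertex_action
        (eigenspace (scalar_extension (H_G A B a b c \<alpha> \<beta>)) (complex_of_real c))"
  using dim_eigenspace_ge_5[of A B a b c \<alpha> \<beta>, where 'k = real]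
    dim_eigenspace_ge_5[of A B a b c \<alpha> \<beta>, where 'k = complex]
    eigenvalue_H_G[of A B a b c \<alpha> \<beta>, where 'k = real]
    eigenvalue_H_G[of A B a b c \<alpha> \<beta>, where 'k = complex]
    reducible_eigenspace[of A B a b c \<alpha> \<beta>, where 'k = real]
    reducible_eigenspace[of A B a b c \<alpha> \<beta>, where 'k = complex]
  by (simp add: scalar_extension_real eigen_multiplicity_def)

end
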